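(* (i) For every sigma-finite measure space $(M,\mathscr F,\sigma)$, the associated Gaussian process $(W_A^{(\sigma)})$ may be realized on $(\Omega_\gamma,\mathscr C_\gamma,Q)$; that is, there is a family of random variables on $(\Omega_\gamma,\mathscr C_\gamma,Q)$ which is a Gaussian process associated with $(M,\mathscr F,\sigma)$. (ii) The realization may be written in terms of a system of independent, identically distributed $\mathcal N(0,1)$ random variables $Z_1,Z_2,\ldots$: if $(\varphi_k)_{k\in\mathbb N}$ is an orthonormal basis of real-valued functions in $\mathbf L_2(M,\mathscr F,\sigma)$, then a realization of $W^{(\sigma)}$ in $(\Omega_\gamma,\mathscr C_\gamma,Q)$ is given by $$W_A^{(\sigma)}(\cdot)=\sum_{k=1}^\infty\left(\int_A\varphi_k(x)\,d\sigma(x)\right)Z_k(\cdot)$$ for all $A\in\mathscr F$ with $\sigma(A)<\infty$, where $Z_k((x_i)_{i\in\mathbb N})=x_k$ for $(x_i)_{i\in\mathbb N}\in\times_{\mathbb N}\mathbb R$.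
   Context: A Gaussian process associated with the sigma-finite measure space $(M,\mathscr F,\sigma)$ is a family $(W_A^{(\sigma)})$ of real random variables on a probability space, indexed by the sets $A\in\mathscr F$ with $\sigma(A)<\infty$, such that every finite subfamily is jointly Gaussian, $\mathbb E[W_A^{(\sigma)}]=0$, and $\mathbb E[W_A^{(\sigma)}W_B^{(\sigma)}]=\sigma(A\cap B)$. $\Omega_\gamma=\times_{\mathbb N}\mathbb R$ is the infinite Cartesian product, $\mathscr C_\gamma$ its cylinder sigma-algebra, and $Q=\times_{\mathbb N}\gamma_1$ the infinite product of the standard Gaussian measure $d\gamma_1(x)=\frac1{\sqrt{2\pi}}e^{-x^2/2}dx$ on $\mathbb R$. The series is understood in $\mathbf L_2(\Omega_\gamma,\mathscr C_\gamma,Q)$.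
   Formalization: Part (i) is proved under the added hypothesis that the real space L_2(M,F,sigma) is separable; this is necessary, since the claim fails for an uncountable product of fair coins, whose L_2 is not separable while L_2(Q) is. *)

theory Defs
  imports "HOL-Probability.Probability"
begin

text \<open>
  Real \<open>L\<^sub>2\<close> spaces are handled through representatives: functions that agree almost everywhere are
  not identified, and \<open>L2_norm\<close> is only a seminorm on representatives.
\<close>

definition L2_space :: "'a measure \<Rightarrow> ('a \<Rightarrow> real) set" where
  "L2_space M = {f \<in> borel_measurable M. integrable M (\<lambda>x. (f x)\<^sup>2)}"

definition L2_inner :: "'a measure \<Rightarrow> ('a \<Rightarrow> real) \<Rightarrow> ('a \<Rightarrow> real) \<Rightarrow> real" where
  "L2_inner M f g = (\<integral>x. f x * g x \<partial>M)"

definition L2_norm :: "'a measure \<Rightarrow> ('a \<Rightarrow> real) \<Rightarrow> real" where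
  "L2_norm M f = sqrt (L2_inner M f f)"

text \<open>The Bochner integral of a non-integrable function is \<open>0\<close>, so \<open>L2_norm\<close> measures a distance
  only between members of \<open>L2_space\<close>; hence the membership conditions below.\<close>

definition L2_sums :: "'a measure \<Rightarrow> (nat \<Rightarrow> 'a \<Rightarrow> real) \<Rightarrow> ('a \<Rightarrow> real) \<Rightarrow> bool" where
  "L2_sums M f g \<longleftrightarrow>
     (\<forall>k. f k \<in> L2_space M) \<and> g \<in> L2_space M \<and>
     (\<lambda>n. L2_norm M (\<lambda>x. (\<Sum>k<n. f k x) - g x)) \<longlonglongrightarrow> 0"

text \<open>Sigma-finiteness does not imply separability of \<open>L\<^sub>2\<close> (an uncountable power of a fair coin is a
  counterexample). A Gaussian process associated with \<open>M\<close> embeds \<open>L\<^sub>2(M)\<close> isometrically into the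
  \<open>L\<^sub>2\<close> space it lives in, so separability is necessary for a realization on a countable product.\<close>

definition L2_separable :: "'a measure \<Rightarrow> bool" where
  "L2_separable M \<longleftrightarrow>
     (\<exists>D. countable D \<and> D \<subseteq> L2_space M \<and>
        (\<forall>f\<in>L2_space M. \<forall>\<epsilon>>0. \<exists>g\<in>D. L2_norm M (\<lambda>x. f x - g x) < \<epsilon>))"

text \<open>An orthonormal sequence whose finite linear combinations are dense.\<close>

definition L2_orthonormal_basis :: "'a measure \<Rightarrow> (nat \<Rightarrow> 'a \<Rightarrow> real) \<Rightarrow> bool" where
  "L2_orthonormal_basis M \<phi> \<longleftrightarrow>
     (\<forall>k. \<phi> k \<in> L2_space M) \<and>
     (\<forall>j k. L2_inner M (\<phi> j) (\<phi> k) = (if j = k then 1 else 0)) \<and>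
     (\<forall>f\<in>L2_space M. \<forall>\<epsilon>>0. \<exists>n c. L2_norm M (\<lambda>x. f x - (\<Sum>k<n. c k * \<phi> k x)) < \<epsilon>)"

text \<open>Constants count as (degenerate) Gaussian variables. This is needed because, for instance,
  \<open>W\<^sub>A\<close> vanishes almost surely when \<open>\<sigma>(A) = 0\<close>.\<close>

definition gaussian_rv :: "'w measure \<Rightarrow> ('w \<Rightarrow> real) \<Rightarrow> bool" where
  "gaussian_rv P X \<longleftrightarrow>
     X \<in> borel_measurable P \<and>
     (\<exists>\<mu>. (\<exists>s>0. distributed P lborel X (normal_density \<mu> s)) \<or> (AE \<omega> in P. X \<omega> = \<mu>))"

text \<open>A finite family is jointly Gaussian if all its linear combinations are Gaussian.\<close>

definition jointly_gaussian :: "'w measure \<Rightarrow> 'i set \<Rightarrow> ('i \<Rightarrow> 'w \<Rightarrow> real) \<Rightarrow> bool" where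
  "jointly_gaussian P I X \<longleftrightarrow> (\<forall>c :: 'i \<Rightarrow> real. gaussian_rv P (\<lambda>\<omega>. \<Sum>i\<in>I. c i * X i \<omega>))"

text \<open>\<open>W A\<close> matters only for \<open>A \<in> fmeasurable M\<close>, the measurable sets of finite measure. The two
  integrals below are genuine: the Gaussian variables \<open>W A\<close> are square integrable.\<close>

definition gaussian_process :: "'w measure \<Rightarrow> 'a measure \<Rightarrow> ('a set \<Rightarrow> 'w \<Rightarrow> real) \<Rightarrow> bool" where
  "gaussian_process P M W \<longleftrightarrow>
     prob_space P \<and>
     (\<forall>I. finite I \<longrightarrow> I \<subseteq> fmeasurable M \<longrightarrow> jointly_gaussian P I W) \<and>
     (\<forall>A\<in>fmeasurable M. (\<integral>\<omega>. W A \<omega> \<partial>P) = 0) \<and>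
     (\<forall>A\<in>fmeasurable M. \<forall>B\<in>fmeasurable M. (\<integral>\<omega>. W A \<omega> * W B \<omega> \<partial>P) = measure M (A \<inter> B))"

text \<open>The measure space \<open>(\<Omega>\<^sub>\<gamma>, \<C>\<^sub>\<gamma>, Q)\<close>; the sigma-algebra of \<open>PiM\<close> is the one generated by the
  cylinder sets. The coordinates are indexed from \<open>0\<close>.\<close>

definition gaussian_product :: "(nat \<Rightarrow> real) measure" where
  "gaussian_product = PiM UNIV (\<lambda>_. density lborel std_normal_density)"

definition Z :: "nat \<Rightarrow> (nat \<Rightarrow> real) \<Rightarrow> real" where
  "Z k x = x k"

end

theory Submission
  imports Defs
begin

text \<open>
  The isometry \<open>f \<mapsto> \<Sum>\<^sub>k \<langle>f, \<phi>\<^sub>k\<rangle> Z\<^sub>k\<close> from \<open>L\<^sub>2(M)\<close> into \<open>L\<^sub>2(Q)\<close> sends indicators to the process: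
  Bessel and the completeness of \<open>L\<^sub>2(Q)\<close> give convergence, Parseval gives the covariance, and the
  limits are Gaussian because \<open>L\<^sub>2\<close> convergence implies convergence of characteristic functions.
  The argument still works if some \<open>\<phi>\<^sub>k\<close> are null, so that Gram-Schmidt applied to a countable dense
  set settles the separable case, including finite-dimensional \<open>L\<^sub>2(M)\<close>.
\<close>

section \<open>Square-integrable functions\<close>

lemma L2_space_measurable [measurable_dest]: "f \<in> L2_space M \<Longrightarrow> f \<in> borel_measurable M"
  by (simp add: L2_space_def)

lemma L2_space_integrable_square: "f \<in> L2_space M \<Longrightarrow> integrable M (\<lambda>x. (f x)\<^sup>2)"
  by (simp add: L2_space_def)

lemma L2_space_integrable_mult:
  assumes f: "f \<in> L2_space M" and g: "g \<in> L2_space M"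
  shows "integrable M (\<lambda>x. f x * g x)"
proof (rule Bochner_Integration.integrable_bound)
  show "integrable M (\<lambda>x. (f x)\<^sup>2 + (g x)\<^sup>2)"
    using f g by (simp add: L2_space_integrable_square)
  show "(\<lambda>x. f x * g x) \<in> borel_measurable M"
    using f g by measurable
  have "\<bar>a * b\<bar> \<le> a\<^sup>2 + b\<^sup>2" for a b :: real
    using zero_le_power2[of "\<bar>a\<bar> - \<bar>b\<bar>"] zero_le_power2[of a] zero_le_power2[of b]
    unfolding power2_diff power2_abs abs_mult by linarith
  then show "AE x in M. norm (f x * g x) \<le> norm ((f x)\<^sup>2 + (g x)\<^sup>2)"
    by simp
qed

lemma L2_space_zero: "(\<lambda>x. 0) \<in> L2_space M"
  by (simp add: L2_space_def)

lemma L2_space_scale: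
  assumes "f \<in> L2_space M" shows "(\<lambda>x. c * f x) \<in> L2_space M"
  using assms by (auto simp: L2_space_def power_mult_distrib)

lemma L2_space_add:
  assumes f: "f \<in> L2_space M" and g: "g \<in> L2_space M"
  shows "(\<lambda>x. f x + g x) \<in> L2_space M"
proof -
  have "integrable M (\<lambda>x. (f x)\<^sup>2 + (g x)\<^sup>2 + 2 * (f x * g x))"
    using f g by (simp add: L2_space_integrable_square L2_space_integrable_mult)
  then show ?thesis
    using f g by (auto simp: L2_space_def power2_sum mult.assoc)
qed

lemma L2_space_diff:
  assumes f: "f \<in> L2_space M" and g: "g \<in> L2_space M"
  shows "(\<lambda>x. f x - g x) \<in> L2_space M"
  using L2_space_add[OF f L2_space_scale[OF g, of "-1"]] by simp

lemma L2_space_sum: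
  "(\<And>i. i \<in> I \<Longrightarrow> f i \<in> L2_space M) \<Longrightarrow> (\<lambda>x. \<Sum>i\<in>I. f i x) \<in> L2_space M"
  by (induction I rule: infinite_finite_induct) (simp_all add: L2_space_zero L2_space_add)

lemma L2_space_lincomb:
  "(\<And>i. i \<in> I \<Longrightarrow> f i \<in> L2_space M) \<Longrightarrow> (\<lambda>x. \<Sum>i\<in>I. c i * f i x) \<in> L2_space M"
  by (intro L2_space_sum L2_space_scale)

lemma L2_space_indicator:
  assumes "A \<in> fmeasurable M" shows "indicator A \<in> L2_space M"
proof -
  have "(\<lambda>x. (indicator A x :: real)\<^sup>2) = indicator A"
    by (auto split: split_indicator)
  then show ?thesis
    using assms by (auto simp: L2_space_def fmeasurable_def integrable_indicator_iff)
qed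

section \<open>The inner product and its seminorm\<close>

lemma L2_inner_commute: "L2_inner M f g = L2_inner M g f"
  by (simp add: L2_inner_def mult.commute)

lemma L2_inner_scale_left: "L2_inner M (\<lambda>x. c * f x) g = c * L2_inner M f g"
  by (simp add: L2_inner_def mult.assoc)

lemma L2_inner_scale_right: "L2_inner M f (\<lambda>x. c * g x) = c * L2_inner M f g"
  by (simp add: L2_inner_commute[of M f] L2_inner_scale_left)

lemma L2_inner_add_left:
  assumes "f \<in> L2_space M" "g \<in> L2_space M" "h \<in> L2_space M"
  shows "L2_inner M (\<lambda>x. f x + g x) h = L2_inner M f h + L2_inner M g h"
  using assms by (simp add: L2_inner_def distrib_right L2_space_integrable_mult)

lemma L2_inner_add_right:
  assumes "f \<in> L2_space M" "g \<in> L2_space M" "h \<in> L2_space M"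
  shows "L2_inner M h (\<lambda>x. f x + g x) = L2_inner M h f + L2_inner M h g"
  using assms by (simp add: L2_inner_commute[of M h] L2_inner_add_left)

lemma L2_inner_diff_left:
  assumes "f \<in> L2_space M" "g \<in> L2_space M" "h \<in> L2_space M"
  shows "L2_inner M (\<lambda>x. f x - g x) h = L2_inner M f h - L2_inner M g h"
  using assms by (simp add: L2_inner_def left_diff_distrib L2_space_integrable_mult)

lemma L2_inner_diff_right:
  assumes "f \<in> L2_space M" "g \<in> L2_space M" "h \<in> L2_space M"
  shows "L2_inner M h (\<lambda>x. f x - g x) = L2_inner M h f - L2_inner M h g"
  using assms by (simp add: L2_inner_commute[of M h] L2_inner_diff_left)

lemma L2_inner_sum_left:
  assumes "\<And>i. i \<in> I \<Longrightarrow> f i \<in> L2_space M" "h \<in> L2_space M"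
  shows "L2_inner M (\<lambda>x. \<Sum>i\<in>I. c i * f i x) h = (\<Sum>i\<in>I. c i * L2_inner M (f i) h)"
  using assms
  by (simp add: L2_inner_def sum_distrib_right mult.assoc Bochner_Integration.integral_sum
      L2_space_integrable_mult)

lemma L2_inner_sum_right:
  assumes "\<And>i. i \<in> I \<Longrightarrow> f i \<in> L2_space M" "h \<in> L2_space M"
  shows "L2_inner M h (\<lambda>x. \<Sum>i\<in>I. c i * f i x) = (\<Sum>i\<in>I. c i * L2_inner M h (f i))"
  using assms by (simp add: L2_inner_commute[of M h] L2_inner_sum_left)

lemma L2_inner_self_nonneg: "0 \<le> L2_inner M f f"
  by (simp add: L2_inner_def)

lemma L2_norm_nonneg: "0 \<le> L2_norm M f"
  by (simp add: L2_norm_def L2_inner_self_nonneg)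

lemma L2_norm_square: "(L2_norm M f)\<^sup>2 = L2_inner M f f"
  by (simp add: L2_norm_def L2_inner_self_nonneg)

lemma L2_norm_minus_commute: "L2_norm M (\<lambda>x. f x - g x) = L2_norm M (\<lambda>x. g x - f x)"
  unfolding L2_norm_def L2_inner_def
  by (simp add: power2_eq_square[symmetric] power2_commute)

lemma L2_norm_zero_AE:
  assumes "f \<in> L2_space M" "L2_norm M f = 0" shows "AE x in M. f x = 0"
proof -
  have "(\<integral>x. (f x)\<^sup>2 \<partial>M) = 0"
    using assms(2) by (simp add: L2_norm_def L2_inner_def power2_eq_square)
  then show ?thesis
    using integral_nonneg_eq_0_iff_AE[OF L2_space_integrable_square[OF assms(1)]] by simp
qed

lemma L2_inner_zero_AE:
  assumes "AE x in M. f x = 0" shows "L2_inner M f g = 0"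
proof -
  have "AE x in M. f x * g x = 0" using assms by eventually_elim simp
  then show ?thesis unfolding L2_inner_def by (rule integral_eq_zero_AE)
qed

lemma L2_Cauchy_Schwarz:
  assumes f: "f \<in> L2_space M" and g: "g \<in> L2_space M"
  shows "\<bar>L2_inner M f g\<bar> \<le> L2_norm M f * L2_norm M g"
proof (cases "L2_norm M g = 0")
  case True
  then have "L2_inner M g f = 0"
    by (intro L2_inner_zero_AE L2_norm_zero_AE g)
  then show ?thesis
    using True by (simp add: L2_inner_commute)
next
  case False
  define A B C where "A = L2_inner M f f" and "B = L2_inner M f g" and "C = L2_inner M g g"
  have C: "C > 0"
    using False L2_inner_self_nonneg[of M g] by (simp add: C_def L2_norm_def)
  \<comment> \<open>Up to the factor \<open>C\<close>, this is the component of \<open>f\<close>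
    orthogonal to \<open>g\<close>; that its inner product with itself is nonnegative is the claim.
    The scaling avoids a division.\<close>
  define h where "h = (\<lambda>x. C * f x - B * g x)"
  have "L2_inner M h h = C * (A * C - B\<^sup>2)"
    unfolding h_def
    by (simp add: L2_inner_diff_left L2_inner_diff_right L2_inner_scale_left L2_inner_scale_right
        L2_space_diff L2_space_scale f g L2_inner_commute[of M g f] flip: A_def B_def C_def)
      (simp add: algebra_simps power2_eq_square)
  then have "0 \<le> A * C - B\<^sup>2"
    using C L2_inner_self_nonneg[of M h] by (simp add: zero_le_mult_iff)
  then have "sqrt (B\<^sup>2) \<le> sqrt (A * C)"
    by (intro real_sqrt_le_mono) simp
  then show ?thesis
    by (simp add: A_def B_def C_def L2_norm_def real_sqrt_mult)
qed

lemma L2_triangle: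
  assumes f: "f \<in> L2_space M" and g: "g \<in> L2_space M"
  shows "L2_norm M (\<lambda>x. f x + g x) \<le> L2_norm M f + L2_norm M g"
proof (rule power2_le_imp_le)
  have "(L2_norm M (\<lambda>x. f x + g x))\<^sup>2
      = (L2_norm M f)\<^sup>2 + 2 * L2_inner M f g + (L2_norm M g)\<^sup>2"
    unfolding L2_norm_square
    by (simp add: L2_inner_add_left L2_inner_add_right L2_space_add f g
        L2_inner_commute[of M g f])
  also have "\<dots> \<le> (L2_norm M f + L2_norm M g)\<^sup>2"
    using L2_Cauchy_Schwarz[OF f g] by (simp add: power2_sum)
  finally show "(L2_norm M (\<lambda>x. f x + g x))\<^sup>2 \<le> (L2_norm M f + L2_norm M g)\<^sup>2" .
qed (simp add: L2_norm_nonneg)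

lemma L2_norm_scale: "L2_norm M (\<lambda>x. c * f x) = \<bar>c\<bar> * L2_norm M f"
  by (simp add: L2_norm_def L2_inner_scale_left L2_inner_scale_right real_sqrt_mult
      flip: mult.assoc power2_eq_square)

text \<open>Writing \<open>F n\<close> as \<open>f + (F n - f)\<close>, and likewise
  \<open>G n\<close>, leaves three error terms by bilinearity, each of which Cauchy-Schwarz sends to
  0. This continuity carries Parseval, covariances and means from partial sums to limits.\<close>

lemma L2_inner_tendsto:
  assumes F: "\<And>n. F n \<in> L2_space M" and G: "\<And>n. G n \<in> L2_space M"
    and f: "f \<in> L2_space M" and g: "g \<in> L2_space M"
    and Ff: "(\<lambda>n. L2_norm M (\<lambda>x. F n x - f x)) \<longlonglongrightarrow> 0"
    and Gg: "(\<lambda>n. L2_norm M (\<lambda>x. G n x - g x)) \<longlonglongrightarrow> 0"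
  shows "(\<lambda>n. L2_inner M (F n) (G n)) \<longlonglongrightarrow> L2_inner M f g"
proof (rule Lim_null_comparison[THEN LIM_zero_cancel])
  let ?p = "\<lambda>n. L2_norm M (\<lambda>x. F n x - f x)" and ?q = "\<lambda>n. L2_norm M (\<lambda>x. G n x - g x)"
  have "\<bar>L2_inner M (F n) (G n) - L2_inner M f g\<bar>
      \<le> ?p n * ?q n + ?p n * L2_norm M g + L2_norm M f * ?q n" for n
  proof -
    have eq: "L2_inner M (F n) (G n) - L2_inner M f g
      = L2_inner M (\<lambda>x. F n x - f x) (\<lambda>x. G n x - g x)
        + L2_inner M (\<lambda>x. F n x - f x) g + L2_inner M f (\<lambda>x. G n x - g x)"
      by (simp add: L2_inner_diff_left L2_inner_diff_right L2_space_diff F G f g)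
    show ?thesis
      unfolding eq
      by (intro order.trans[OF abs_triangle_ineq] add_mono L2_Cauchy_Schwarz L2_space_diff F G f g)
  qed
  then show "\<forall>\<^sub>F n in sequentially. norm (L2_inner M (F n) (G n) - L2_inner M f g)
      \<le> ?p n * ?q n + ?p n * L2_norm M g + L2_norm M f * ?q n"
    by simp
  show "(\<lambda>n. ?p n * ?q n + ?p n * L2_norm M g + L2_norm M f * ?q n) \<longlonglongrightarrow> 0"
    using Ff Gg by (intro tendsto_add_zero tendsto_mult_zero tendsto_mult_left_zero tendsto_mult_right_zero)
qed

section \<open>Series that converge in L2\<close>

lemma L2_sums_inner:
  assumes "L2_sums M f g" "L2_sums M f' g'"
  shows "(\<lambda>n. L2_inner M (\<lambda>x. \<Sum>k<n. f k x) (\<lambda>x. \<Sum>k<n. f' k x)) \<longlonglongrightarrow> L2_inner M g g'"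
  using assms unfolding L2_sums_def by (intro L2_inner_tendsto L2_space_sum) auto

lemma L2_sums_zero: "L2_sums M (\<lambda>k x. 0) (\<lambda>x. 0)"
  by (simp add: L2_sums_def L2_space_zero L2_norm_def L2_inner_def)

lemma L2_sums_scale:
  assumes "L2_sums M f g" shows "L2_sums M (\<lambda>k x. c * f k x) (\<lambda>x. c * g x)"
proof -
  have "(\<lambda>n. \<bar>c\<bar> * L2_norm M (\<lambda>x. (\<Sum>k<n. f k x) - g x)) \<longlonglongrightarrow> 0"
    using assms by (intro tendsto_mult_right_zero) (simp add: L2_sums_def)
  then show ?thesis
    using assms unfolding L2_sums_def L2_norm_scale[symmetric]
    by (simp add: L2_space_scale right_diff_distrib sum_distrib_left)
qed

lemma L2_sums_add:
  assumes "L2_sums M f g" "L2_sums M f' g'"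
  shows "L2_sums M (\<lambda>k x. f k x + f' k x) (\<lambda>x. g x + g' x)"
proof -
  have L: "\<And>k. f k \<in> L2_space M" "\<And>k. f' k \<in> L2_space M" "g \<in> L2_space M" "g' \<in> L2_space M"
    using assms by (auto simp: L2_sums_def)
  let ?r = "\<lambda>n x. (\<Sum>k<n. f k x) - g x" and ?r' = "\<lambda>n x. (\<Sum>k<n. f' k x) - g' x"
  have "(\<lambda>n. L2_norm M (\<lambda>x. ?r n x + ?r' n x)) \<longlonglongrightarrow> 0"
  proof (rule Lim_null_comparison)
    show "\<forall>\<^sub>F n in sequentially. norm (L2_norm M (\<lambda>x. ?r n x + ?r' n x))
        \<le> L2_norm M (?r n) + L2_norm M (?r' n)"
      using L by (auto simp: L2_norm_nonneg intro!: always_eventually L2_triangle L2_space_diff L2_space_sum)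
    show "(\<lambda>n. L2_norm M (?r n) + L2_norm M (?r' n)) \<longlonglongrightarrow> 0"
      using assms by (auto simp: L2_sums_def intro: tendsto_add_zero)
  qed
  moreover have "?r n x + ?r' n x = (\<Sum>k<n. f k x + f' k x) - (g x + g' x)" for n x
    by (simp add: sum.distrib)
  ultimately show ?thesis
    using L by (simp add: L2_sums_def L2_space_add)
qed

lemma L2_sums_lincomb:
  assumes "finite I" "\<And>i. i \<in> I \<Longrightarrow> L2_sums M (f i) (g i)"
  shows "L2_sums M (\<lambda>k x. \<Sum>i\<in>I. c i * f i k x) (\<lambda>x. \<Sum>i\<in>I. c i * g i x)"
  using assms by (induction I) (simp_all add: L2_sums_zero L2_sums_add L2_sums_scale)

section \<open>Completeness of L2 over a probability space\<close>

text \<open>Cauchy-Schwarz against the constant 1, whose norm is 1 on a probability space. The bound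
  on first moments serves both completeness and the comparison of characteristic functions.\<close>

lemma (in prob_space) integral_abs_le_L2_norm:
  assumes f: "f \<in> L2_space M"
  shows "integrable M f" "(\<integral>x. \<bar>f x\<bar> \<partial>M) \<le> L2_norm M f"
proof -
  show int: "integrable M f"
    using f by (auto simp: L2_space_def intro: square_integrable_imp_integrable)
  have f': "(\<lambda>x. \<bar>f x\<bar>) \<in> L2_space M" and one: "(\<lambda>x. 1) \<in> L2_space M"
    using f by (auto simp: L2_space_def)
  have "L2_norm M (\<lambda>x. \<bar>f x\<bar>) = L2_norm M f" "L2_norm M (\<lambda>x. 1) = 1"
    by (simp_all add: L2_norm_def L2_inner_def prob_space)
  then show "(\<integral>x. \<bar>f x\<bar> \<partial>M) \<le> L2_norm M f"
    using L2_Cauchy_Schwarz[OF f' one] by (simp add: L2_inner_def)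
qed

text \<open>The Riesz-Fischer argument: a subsequence whose increments are dominated by a geometric
  series converges almost everywhere, and Fatou's lemma makes its pointwise limit the limit in norm
  of the whole sequence.\<close>

theorem (in prob_space) L2_complete:
  assumes f: "\<And>n. f n \<in> L2_space M"
    and Cauchy: "\<And>e. e > 0 \<Longrightarrow> \<exists>N. \<forall>m\<ge>N. \<forall>n\<ge>N. L2_norm M (\<lambda>x. f m x - f n x) < e"
  shows "\<exists>g\<in>L2_space M. (\<lambda>n. L2_norm M (\<lambda>x. f n x - g x)) \<longlonglongrightarrow> 0"
proof -
  note [measurable] = L2_space_measurable[OF f]
  define P where "P j N \<longleftrightarrow> (\<forall>m\<ge>N. \<forall>n\<ge>N. L2_norm M (\<lambda>x. f m x - f n x) < (1/2)^j)" for j N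
  have "\<exists>N. P j N" for j
    unfolding P_def by (rule Cauchy) simp
  then obtain N where N: "P j (N j)" for j
    by metis
  \<comment> \<open>The maximum puts \<open>r i\<close> beyond the threshold \<open>N j\<close> for
    every \<open>j \<le> i\<close>.\<close>
  define r where "r j = Max (N ` {..j})" for j
  have r_ge: "N j \<le> r i" if "j \<le> i" for i j
    unfolding r_def using that by (intro Max_ge) auto
  have close: "L2_norm M (\<lambda>x. f m x - f (r i) x) < (1/2)^j" if "m \<ge> N j" "i \<ge> j" for m i j
    using N[of j] that r_ge[of j i] unfolding P_def by blast
  define D where "D j x = f (r (Suc j)) x - f (r j) x" for j x
  have D: "D j \<in> L2_space M" for j
    unfolding D_def by (intro L2_space_diff f)
  have int_D: "(\<integral>\<^sup>+x. ennreal \<bar>D j x\<bar> \<partial>M) \<le> ennreal ((1/2)^j)" for j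
  proof -
    have "(\<integral>\<^sup>+x. ennreal \<bar>D j x\<bar> \<partial>M) = ennreal (\<integral>x. \<bar>D j x\<bar> \<partial>M)"
      by (intro nn_integral_eq_integral integrable_abs integral_abs_le_L2_norm D) simp
    also have "\<dots> \<le> ennreal (L2_norm M (D j))"
      by (intro ennreal_leI integral_abs_le_L2_norm D)
    also have "\<dots> \<le> ennreal ((1/2)^j)"
      unfolding D_def using close[of j "r (Suc j)" j] r_ge[of j "Suc j"] by (intro ennreal_leI) simp
    finally show ?thesis .
  qed
  have [measurable]: "D j \<in> borel_measurable M" for j
    using D by (rule L2_space_measurable)
  \<comment> \<open>The first moments of the increments sum to a finite value, so the telescoping
    series of increments converges absolutely almost everywhere.\<close>
  have "(\<integral>\<^sup>+x. (\<Sum>j. ennreal \<bar>D j x\<bar>) \<partial>M) = (\<Sum>j. \<integral>\<^sup>+x. ennreal \<bar>D j x\<bar> \<partial>M)"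
    by (intro nn_integral_suminf) measurable
  also have "\<dots> \<le> (\<Sum>j. ennreal ((1/2)^j))"
    by (intro suminf_le int_D) auto
  also have "\<dots> = ennreal (\<Sum>j. (1/2)^j)"
    by (intro suminf_ennreal2) (auto simp: summable_geometric)
  finally have "(\<integral>\<^sup>+x. (\<Sum>j. ennreal \<bar>D j x\<bar>) \<partial>M) \<noteq> \<infinity>"
    by (auto simp: top_unique)
  then have "AE x in M. (\<Sum>j. ennreal \<bar>D j x\<bar>) \<noteq> \<infinity>"
    by (intro nn_integral_PInf_AE) measurable
  then have "AE x in M. convergent (\<lambda>j. f (r j) x)"
  proof eventually_elim
    case (elim x)
    then have "summable (\<lambda>j. \<bar>D j x\<bar>)"
      by (intro summable_suminf_not_top) auto
    then have "summable (\<lambda>j. D j x)"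
      by (rule summable_rabs_cancel)
    then have "convergent (\<lambda>n. (\<Sum>j<n. D j x))"
      by (simp add: summable_iff_convergent)
    moreover have "(\<Sum>j<n. D j x) = f (r n) x - f (r 0) x" for n
      unfolding D_def using sum_lessThan_telescope[of "\<lambda>j. f (r j) x" n] by simp
    ultimately have "convergent (\<lambda>n. f (r 0) x + (f (r n) x - f (r 0) x))"
      by (intro convergent_add convergent_const) simp
    then show ?case by simp
  qed
  \<comment> \<open>Where the subsequence diverges, \<open>lim\<close> is some unspecified value;
    this concerns only a null set, and \<open>g\<close> is still measurable.\<close>
  moreover define g where "g x = lim (\<lambda>j. f (r j) x)" for x
  ultimately have lim_g: "AE x in M. (\<lambda>j. f (r j) x) \<longlonglongrightarrow> g x"
    by (auto simp: convergent_LIMSEQ_iff elim: eventually_mono)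
  have [measurable]: "g \<in> borel_measurable M"
    unfolding g_def by measurable
  have diff: "(\<lambda>x. f n x - g x) \<in> L2_space M \<and> L2_norm M (\<lambda>x. f n x - g x) \<le> (1/2)^j"
    if n: "n \<ge> N j" for n j
  proof -
    have "(\<integral>\<^sup>+x. ennreal ((f n x - g x)\<^sup>2) \<partial>M)
        = (\<integral>\<^sup>+x. liminf (\<lambda>i. ennreal ((f n x - f (r i) x)\<^sup>2)) \<partial>M)"
    proof (intro nn_integral_cong_AE)
      show "AE x in M. ennreal ((f n x - g x)\<^sup>2) = liminf (\<lambda>i. ennreal ((f n x - f (r i) x)\<^sup>2))"
        using lim_g
      proof eventually_elim
        case (elim x)
        then have "(\<lambda>i. ennreal ((f n x - f (r i) x)\<^sup>2)) \<longlonglongrightarrow> ennreal ((f n x - g x)\<^sup>2)"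
          by (intro tendsto_ennrealI tendsto_intros)
        then show ?case
          by (rule lim_imp_Liminf[OF trivial_limit_sequentially, symmetric])
      qed
    qed
    \<comment> \<open>Fatou's lemma, with \<open>n\<close> fixed and \<open>r i\<close> running
      along the subsequence.\<close>
    also have "\<dots> \<le> liminf (\<lambda>i. \<integral>\<^sup>+x. ennreal ((f n x - f (r i) x)\<^sup>2) \<partial>M)"
      by (intro nn_integral_liminf) measurable
    also have "\<dots> \<le> ennreal (((1/2)^j)\<^sup>2)"
    proof (intro Liminf_le eventually_sequentiallyI)
      fix i assume i: "j \<le> i"
      have fi: "(\<lambda>x. f n x - f (r i) x) \<in> L2_space M"
        by (intro L2_space_diff f)
      have "(\<integral>\<^sup>+x. ennreal ((f n x - f (r i) x)\<^sup>2) \<partial>M)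
          = ennreal ((L2_norm M (\<lambda>x. f n x - f (r i) x))\<^sup>2)"
        using L2_space_integrable_square[OF fi]
        by (simp add: L2_norm_square L2_inner_def nn_integral_eq_integral flip: power2_eq_square)
      also have "\<dots> \<le> ennreal (((1/2)^j)\<^sup>2)"
        using close[OF n i] by (intro ennreal_leI power_mono) (simp_all add: L2_norm_nonneg)
      finally show "(\<integral>\<^sup>+x. ennreal ((f n x - f (r i) x)\<^sup>2) \<partial>M) \<le> ennreal (((1/2)^j)\<^sup>2)" .
    qed simp
    finally have le: "(\<integral>\<^sup>+x. ennreal ((f n x - g x)\<^sup>2) \<partial>M) \<le> ennreal (((1/2)^j)\<^sup>2)" .
    then have int: "integrable M (\<lambda>x. (f n x - g x)\<^sup>2)"
      by (intro integrableI_bounded) (auto simp: le_less_trans)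
    then have "ennreal (L2_inner M (\<lambda>x. f n x - g x) (\<lambda>x. f n x - g x)) \<le> ennreal (((1/2)^j)\<^sup>2)"
      using le by (simp add: L2_inner_def nn_integral_eq_integral flip: power2_eq_square)
    then have "(L2_norm M (\<lambda>x. f n x - g x))\<^sup>2 \<le> ((1/2)^j)\<^sup>2"
      by (simp add: L2_norm_square)
    then have "L2_norm M (\<lambda>x. f n x - g x) \<le> (1/2)^j"
      by (rule power2_le_imp_le) simp
    with int show ?thesis
      by (auto simp: L2_space_def)
  qed
  \<comment> \<open>Membership of \<open>g\<close> follows by writing it as \<open>f (N 0)\<close>
    minus the square-integrable difference \<open>f (N 0) - g\<close>.\<close>
  have "(\<lambda>x. f (N 0) x - (f (N 0) x - g x)) \<in> L2_space M"
    by (rule L2_space_diff[OF f conjunct1[OF diff[OF order_refl]]])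
  then have "g \<in> L2_space M" by simp
  moreover have "(\<lambda>n. L2_norm M (\<lambda>x. f n x - g x)) \<longlonglongrightarrow> 0"
  proof (rule LIMSEQ_I)
    fix e :: real assume "e > 0"
    then obtain j where j: "(1/2)^j < e"
      using real_arch_pow_inv[of e "1/2"] by auto
    have "norm (L2_norm M (\<lambda>x. f n x - g x) - 0) < e" if "n \<ge> N j" for n
      using diff[OF that] j L2_norm_nonneg[of M "\<lambda>x. f n x - g x"] by simp
    then show "\<exists>no. \<forall>n\<ge>no. norm (L2_norm M (\<lambda>x. f n x - g x) - 0) < e" by blast
  qed
  ultimately show ?thesis by blast
qed

section \<open>Orthonormal systems with null vectors\<close>

text \<open>Admitting null vectors lets a family indexed by all of \<open>nat\<close> serve also
  when the space has finite dimension, and lets a linearly dependent sequence be orthonormalized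
  without renumbering.\<close>

definition L2_orthonormal_or_null :: "'a measure \<Rightarrow> (nat \<Rightarrow> 'a \<Rightarrow> real) \<Rightarrow> bool" where
  "L2_orthonormal_or_null M \<phi> \<longleftrightarrow>
     (\<forall>k. \<phi> k \<in> L2_space M \<and> L2_inner M (\<phi> k) (\<phi> k) \<in> {0, 1}) \<and>
     (\<forall>j k. j \<noteq> k \<longrightarrow> L2_inner M (\<phi> j) (\<phi> k) = 0)"

definition L2_total :: "'a measure \<Rightarrow> (nat \<Rightarrow> 'a \<Rightarrow> real) \<Rightarrow> bool" where
  "L2_total M \<phi> \<longleftrightarrow>
     (\<forall>f\<in>L2_space M. \<forall>\<epsilon>>0. \<exists>n c. L2_norm M (\<lambda>x. f x - (\<Sum>k<n. c k * \<phi> k x)) < \<epsilon>)"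

lemma L2_orthonormal_basis_iff:
  "L2_orthonormal_basis M \<phi> \<longleftrightarrow>
     L2_orthonormal_or_null M \<phi> \<and> (\<forall>k. L2_inner M (\<phi> k) (\<phi> k) = 1) \<and> L2_total M \<phi>"
  by (auto simp: L2_orthonormal_basis_def L2_orthonormal_or_null_def L2_total_def)

lemma L2_inner_orthonormal_or_null:
  assumes "L2_orthonormal_or_null M \<phi>" "finite K"
  shows "L2_inner M (\<lambda>x. \<Sum>k\<in>K. a k * \<phi> k x) (\<lambda>x. \<Sum>k\<in>K. b k * \<phi> k x)
    = (\<Sum>k\<in>K. a k * b k * L2_inner M (\<phi> k) (\<phi> k))"
proof -
  have \<phi>: "\<phi> k \<in> L2_space M" and ortho: "j \<noteq> k \<Longrightarrow> L2_inner M (\<phi> j) (\<phi> k) = 0" for j k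
    using assms(1) by (auto simp: L2_orthonormal_or_null_def)
  have "L2_inner M (\<lambda>x. \<Sum>k\<in>K. a k * \<phi> k x) (\<lambda>x. \<Sum>k\<in>K. b k * \<phi> k x)
      = (\<Sum>j\<in>K. \<Sum>k\<in>K. a j * b k * L2_inner M (\<phi> j) (\<phi> k))"
    by (simp add: L2_inner_sum_left L2_inner_sum_right L2_space_lincomb \<phi> sum_distrib_left mult.assoc)
  also have "\<dots> = (\<Sum>j\<in>K. \<Sum>k\<in>K. if k = j then a k * b k * L2_inner M (\<phi> k) (\<phi> k) else 0)"
    by (intro sum.cong refl) (auto simp: ortho)
  finally show ?thesis
    using assms(2) by simp
qed

text \<open>Either \<open>\<phi> k\<close> has norm 1, or it vanishes almost everywhere and the
  coefficient is 0 as well. This is why null vectors leave the usual formulas for Fourier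
  coefficients intact.\<close>

lemma L2_coefficient_mult_norm:
  assumes \<phi>: "L2_orthonormal_or_null M \<phi>"
  shows "L2_inner M f (\<phi> k) * L2_inner M (\<phi> k) (\<phi> k) = L2_inner M f (\<phi> k)"
proof (cases "L2_inner M (\<phi> k) (\<phi> k) = 0")
  case True
  then have "L2_inner M (\<phi> k) f = 0"
    using \<phi> by (intro L2_inner_zero_AE L2_norm_zero_AE)
      (auto simp: L2_orthonormal_or_null_def L2_norm_def)
  then show ?thesis
    by (simp add: L2_inner_commute)
qed (use \<phi> in \<open>auto simp: L2_orthonormal_or_null_def\<close>)

text \<open>Completing the square in each coefficient. The last sum is nonnegative and vanishes for
  the Fourier coefficients, which are therefore the best choice.\<close>

lemma L2_dist_square_lincomb:
  assumes \<phi>: "L2_orthonormal_or_null M \<phi>" and f: "f \<in> L2_space M"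
  shows "(L2_norm M (\<lambda>x. f x - (\<Sum>k<n. c k * \<phi> k x)))\<^sup>2
    = L2_inner M f f - (\<Sum>k<n. (L2_inner M f (\<phi> k))\<^sup>2)
      + (\<Sum>k<n. (c k - L2_inner M f (\<phi> k))\<^sup>2 * L2_inner M (\<phi> k) (\<phi> k))"
proof -
  define u where "u k = L2_inner M (\<phi> k) (\<phi> k)" for k
  define a where "a k = L2_inner M f (\<phi> k)" for k
  have \<phi>L: "\<phi> k \<in> L2_space M" for k
    using \<phi> by (auto simp: L2_orthonormal_or_null_def)
  have au: "a k * u k = a k" for k
    unfolding a_def u_def by (rule L2_coefficient_mult_norm[OF \<phi>])
  let ?s = "\<lambda>x. \<Sum>k<n. c k * \<phi> k x"
  have "L2_inner M ?s ?s = (\<Sum>k<n. c k * c k * u k)"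
    by (simp add: L2_inner_orthonormal_or_null[OF \<phi>] u_def)
  moreover have s: "L2_inner M f ?s = (\<Sum>k<n. c k * a k)"
    by (simp add: L2_inner_sum_right \<phi>L f a_def)
  moreover have "L2_inner M ?s f = (\<Sum>k<n. c k * a k)"
    using s by (simp add: L2_inner_commute)
  ultimately have "(L2_norm M (\<lambda>x. f x - ?s x))\<^sup>2
      = L2_inner M f f - 2 * (\<Sum>k<n. c k * a k) + (\<Sum>k<n. c k * c k * u k)"
    unfolding L2_norm_square
    by (simp add: L2_inner_diff_left L2_inner_diff_right L2_space_diff L2_space_lincomb f \<phi>L)
  \<comment> \<open>In the expanded square, \<open>au\<close> replaces \<open>a k * u k\<close> by
    \<open>a k\<close>, which removes \<open>u k\<close> from all terms but the first.\<close>
  moreover have "(c k - a k)\<^sup>2 * u k = c k * c k * u k - 2 * (c k * a k) + (a k)\<^sup>2" for k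
  proof -
    have "(c k - a k)\<^sup>2 * u k = c k * c k * u k - 2 * (c k * (a k * u k)) + a k * (a k * u k)"
      by (simp add: power2_eq_square algebra_simps)
    then show ?thesis by (simp add: au power2_eq_square)
  qed
  ultimately show ?thesis
    by (simp add: sum.distrib sum_subtractf sum_distrib_left flip: a_def u_def)
qed

text \<open>Totality supplies one combination of length \<open>n\<close> close to \<open>f\<close>.
  Fourier partial sums of length at least \<open>n\<close> are no worse: they beat every combination
  of length \<open>n\<close>, and their error decreases with the length.\<close>

lemma L2_sums_expansion:
  assumes \<phi>: "L2_orthonormal_or_null M \<phi>" and total: "L2_total M \<phi>" and f: "f \<in> L2_space M"
  shows "L2_sums M (\<lambda>k x. L2_inner M f (\<phi> k) * \<phi> k x) f"
proof -
  let ?a = "\<lambda>k. L2_inner M f (\<phi> k)"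
  let ?d = "\<lambda>n. L2_norm M (\<lambda>x. f x - (\<Sum>k<n. ?a k * \<phi> k x))"
  have u: "0 \<le> L2_inner M (\<phi> k) (\<phi> k)" for k
    by (rule L2_inner_self_nonneg)
  have "?d \<longlonglongrightarrow> 0"
  proof (rule LIMSEQ_I)
    fix e :: real assume "e > 0"
    then obtain n c where n: "L2_norm M (\<lambda>x. f x - (\<Sum>k<n. c k * \<phi> k x)) < e"
      using total f unfolding L2_total_def by blast
    have "norm (?d m - 0) < e" if "m \<ge> n" for m
    proof -
      have "(?d m)\<^sup>2 = L2_inner M f f - (\<Sum>k<m. (?a k)\<^sup>2)"
        by (simp add: L2_dist_square_lincomb[OF \<phi> f])
      also have "\<dots> \<le> L2_inner M f f - (\<Sum>k<n. (?a k)\<^sup>2)"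
        using that by (intro diff_left_mono sum_mono2) auto
      also have "\<dots> \<le> (L2_norm M (\<lambda>x. f x - (\<Sum>k<n. c k * \<phi> k x)))\<^sup>2"
        unfolding L2_dist_square_lincomb[OF \<phi> f] by (simp add: sum_nonneg u)
      finally have "?d m \<le> L2_norm M (\<lambda>x. f x - (\<Sum>k<n. c k * \<phi> k x))"
        by (rule power2_le_imp_le) (rule L2_norm_nonneg)
      then show ?thesis
        using n by (simp add: L2_norm_nonneg)
    qed
    then show "\<exists>no. \<forall>n\<ge>no. norm (?d n - 0) < e" by blast
  qed
  then show ?thesis
    using \<phi> f by (auto simp: L2_sums_def L2_orthonormal_or_null_def L2_space_scale
        L2_norm_minus_commute[of M f])
qed

text \<open>By orthogonality the inner products of the partial sums of both expansions are the
  partial sums of the scalar series; continuity of the inner product gives the limit.\<close>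

theorem L2_Parseval:
  assumes \<phi>: "L2_orthonormal_or_null M \<phi>" "L2_total M \<phi>"
    and f: "f \<in> L2_space M" and g: "g \<in> L2_space M"
  shows "(\<lambda>k. L2_inner M f (\<phi> k) * L2_inner M g (\<phi> k)) sums L2_inner M f g"
  using L2_sums_inner[OF L2_sums_expansion[OF \<phi> f] L2_sums_expansion[OF \<phi> g]]
  by (simp add: sums_def L2_inner_orthonormal_or_null[OF \<phi>(1)] mult.assoc
      L2_coefficient_mult_norm[OF \<phi>(1)])

text \<open>By orthogonality the squared norm of a block of terms is at most the corresponding block
  of the series of \<open>(a k)\<^sup>2\<close>, so the partial sums are Cauchy and completeness
  applies.\<close>

lemma (in prob_space) L2_sums_square_summable:
  assumes \<phi>: "L2_orthonormal_or_null M \<phi>" and a: "summable (\<lambda>k. (a k)\<^sup>2)"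
  shows "\<exists>X. L2_sums M (\<lambda>k x. a k * \<phi> k x) X"
proof -
  let ?S = "\<lambda>n x. \<Sum>k<n. a k * \<phi> k x"
  have \<phi>L: "\<phi> k \<in> L2_space M" and u: "L2_inner M (\<phi> k) (\<phi> k) \<le> 1" for k
    using \<phi> by (auto simp: L2_orthonormal_or_null_def dest!: spec[of _ k])
  have "\<exists>g\<in>L2_space M. (\<lambda>n. L2_norm M (\<lambda>x. ?S n x - g x)) \<longlonglongrightarrow> 0"
  proof (rule L2_complete)
    show "?S n \<in> L2_space M" for n
      by (intro L2_space_lincomb \<phi>L)
    fix e :: real assume e: "e > 0"
    obtain N where N: "norm (\<Sum>k=n..<m. (a k)\<^sup>2) < e\<^sup>2" if "n \<ge> N" for m n
      using a e unfolding summable_Cauchy by (meson zero_less_power)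
    have less: "L2_norm M (\<lambda>x. ?S m x - ?S n x) < e" if "N \<le> n" "n \<le> m" for m n
    proof -
      have "?S m x - ?S n x = (\<Sum>k=n..<m. a k * \<phi> k x)" for x
        using sum_diff_nat_ivl[of 0 n m "\<lambda>k. a k * \<phi> k x"] that by (simp add: atLeast0LessThan)
      then have "(L2_norm M (\<lambda>x. ?S m x - ?S n x))\<^sup>2
          = (\<Sum>k=n..<m. a k * a k * L2_inner M (\<phi> k) (\<phi> k))"
        by (simp add: L2_norm_square L2_inner_orthonormal_or_null[OF \<phi>])
      also have "\<dots> \<le> (\<Sum>k=n..<m. (a k)\<^sup>2)"
        by (intro sum_mono) (simp add: power2_eq_square mult_left_le u)
      also have "\<dots> < e\<^sup>2"
        using N[OF that(1), of m] by simp
      finally show ?thesis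
        by (rule power_less_imp_less_base) (use e in simp)
    qed
    have "L2_norm M (\<lambda>x. ?S m x - ?S n x) < e" if "N \<le> m" "N \<le> n" for m n
      using less[of n m] less[of m n] that L2_norm_minus_commute[of M "?S m" "?S n"]
      by (cases "n \<le> m") auto
    then show "\<exists>N. \<forall>m\<ge>N. \<forall>n\<ge>N. L2_norm M (\<lambda>x. ?S m x - ?S n x) < e"
      by blast
  qed
  then show ?thesis
    by (auto simp: L2_sums_def L2_space_scale \<phi>L)
qed

section \<open>Gram-Schmidt orthonormalization in the separable case\<close>

text \<open>Since \<open>inverse 0 = 0\<close>, a remainder of norm \<open>0\<close> becomes the zero function.\<close>

fun gram_schmidt :: "'a measure \<Rightarrow> (nat \<Rightarrow> 'a \<Rightarrow> real) \<Rightarrow> nat \<Rightarrow> 'a \<Rightarrow> real" where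
  "gram_schmidt M d k =
    (let r = (\<lambda>x. d k x - (\<Sum>j<k. L2_inner M (d k) (gram_schmidt M d j) * gram_schmidt M d j x))
     in (\<lambda>x. inverse (L2_norm M r) * r x))"

declare gram_schmidt.simps [simp del]

lemma gram_schmidt_orthonormal_or_null:
  assumes d: "\<And>k. d k \<in> L2_space M"
  shows "L2_orthonormal_or_null M (gram_schmidt M d)"
proof -
  let ?e = "gram_schmidt M d"
  have "?e k \<in> L2_space M \<and> L2_inner M (?e k) (?e k) \<in> {0, 1} \<and> (\<forall>j<k. L2_inner M (?e k) (?e j) = 0)"
    for k
  proof (induction k rule: less_induct)
    case (less k)
    define r where "r = (\<lambda>x. d k x - (\<Sum>j<k. L2_inner M (d k) (?e j) * ?e j x))"
    have ek: "?e k = (\<lambda>x. inverse (L2_norm M r) * r x)"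
      by (subst gram_schmidt.simps) (simp add: r_def Let_def)
    have e: "?e j \<in> L2_space M" if "j < k" for j
      using less that by blast
    have r: "r \<in> L2_space M"
      unfolding r_def by (intro L2_space_diff d L2_space_lincomb) (auto intro: e)
    have "L2_inner M r (?e j) = 0" if j: "j < k" for j
    proof -
      \<comment> \<open>The induction hypothesis pairs an index only with smaller ones; symmetry
        covers the other order.\<close>
      have ortho: "L2_inner M (?e i) (?e j) = 0" if "i < k" "i \<noteq> j" for i
        using less[of i] less[of j] that j L2_inner_commute[of M "?e i" "?e j"]
        by (cases "i < j") auto
      have "L2_inner M r (?e j)
          = L2_inner M (d k) (?e j) - (\<Sum>i<k. L2_inner M (d k) (?e i) * L2_inner M (?e i) (?e j))"
        unfolding r_def using d j e
        by (subst L2_inner_diff_left)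
          (auto intro!: L2_space_lincomb L2_inner_sum_left)
      also have "(\<Sum>i<k. L2_inner M (d k) (?e i) * L2_inner M (?e i) (?e j))
          = (\<Sum>i<k. if i = j then L2_inner M (d k) (?e j) * L2_inner M (?e j) (?e j) else 0)"
        by (intro sum.cong refl) (auto simp: ortho)
      also have "\<dots> = L2_inner M (d k) (?e j) * L2_inner M (?e j) (?e j)"
        using j by simp
      \<comment> \<open>If \<open>?e j\<close> is null, the coefficient itself is 0, so both sides
        agree in that case too.\<close>
      also have "\<dots> = L2_inner M (d k) (?e j)"
      proof (cases "L2_inner M (?e j) (?e j) = 0")
        case True
        then have "L2_inner M (?e j) (d k) = 0"
          using e[OF j] by (intro L2_inner_zero_AE L2_norm_zero_AE) (auto simp: L2_norm_def)
        then show ?thesis by (simp add: L2_inner_commute)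
      qed (use less[OF j] in auto)
      finally show ?thesis by simp
    qed
    moreover have "L2_inner M (?e k) (?e k) \<in> {0, 1}"
    proof -
      have "L2_inner M (?e k) (?e k) = (inverse (L2_norm M r) * L2_norm M r)\<^sup>2"
        unfolding ek L2_inner_scale_left L2_inner_scale_right
        by (simp add: power_mult_distrib L2_norm_square power2_eq_square[of "inverse _"])
      then show ?thesis
        by (cases "L2_norm M r = 0") simp_all
    qed
    ultimately show ?case
      using r by (simp add: ek L2_inner_scale_left L2_space_scale)
  qed
  note * = this
  have "L2_inner M (?e j) (?e k) = 0" if "j \<noteq> k" for j k
    using *[of j] *[of k] that L2_inner_commute[of M "?e j" "?e k"] by (cases "j < k") auto
  with * show ?thesis
    unfolding L2_orthonormal_or_null_def by blast
qed

text \<open>Multiplying by the norm of the remainder undoes the normalization. A remainder of norm 0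
  may still be nonzero at points of a null set, so the equality is stated up to norm 0 rather than
  pointwise.\<close>

lemma gram_schmidt_span:
  assumes d: "\<And>k. d k \<in> L2_space M"
  shows "\<exists>c. L2_norm M (\<lambda>x. d k x - (\<Sum>j<Suc k. c j * gram_schmidt M d j x)) = 0"
proof -
  let ?e = "gram_schmidt M d"
  define r where "r = (\<lambda>x. d k x - (\<Sum>j<k. L2_inner M (d k) (?e j) * ?e j x))"
  have ek: "?e k = (\<lambda>x. inverse (L2_norm M r) * r x)"
    by (subst gram_schmidt.simps) (simp add: r_def Let_def)
  define c where "c = (\<lambda>j. if j = k then L2_norm M r else L2_inner M (d k) (?e j))"
  have "d k x - (\<Sum>j<Suc k. c j * ?e j x) = (1 - L2_norm M r * inverse (L2_norm M r)) * r x" for x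
  proof -
    have "(\<Sum>j<Suc k. c j * ?e j x) = (\<Sum>j<k. L2_inner M (d k) (?e j) * ?e j x) + L2_norm M r * ?e k x"
      by (simp add: c_def)
    also have "\<dots> = d k x - r x + L2_norm M r * ?e k x"
      by (simp add: r_def)
    finally show ?thesis
      by (simp add: ek algebra_simps)
  qed
  then have "L2_norm M (\<lambda>x. d k x - (\<Sum>j<Suc k. c j * ?e j x)) = 0"
    by (simp only: L2_norm_scale) (cases "L2_norm M r = 0"; simp)
  then show ?thesis by blast
qed

theorem L2_separable_imp_basis:
  assumes "L2_separable M"
  shows "\<exists>\<phi>. L2_orthonormal_or_null M \<phi> \<and> L2_total M \<phi>"
proof -
  obtain D where D: "countable D" "D \<subseteq> L2_space M"
    and dense: "\<And>f \<epsilon>. f \<in> L2_space M \<Longrightarrow> \<epsilon> > 0 \<Longrightarrow> \<exists>g\<in>D. L2_norm M (\<lambda>x. f x - g x) < \<epsilon>"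
    using assms unfolding L2_separable_def by blast
  \<comment> \<open>Nonemptiness allows an enumeration of \<open>D\<close> by all of
    \<open>nat\<close>, with repetitions if \<open>D\<close> is finite.\<close>
  have "D \<noteq> {}"
    using dense[OF L2_space_zero zero_less_one] by blast
  define d where "d = from_nat_into D"
  have range_d: "range d = D"
    unfolding d_def using \<open>D \<noteq> {}\<close> D(1) by (rule range_from_nat_into)
  have d: "d k \<in> L2_space M" for k
    using range_d D(2) by blast
  let ?e = "gram_schmidt M d"
  have e: "?e k \<in> L2_space M" for k
    using gram_schmidt_orthonormal_or_null[of d M] d by (auto simp: L2_orthonormal_or_null_def)
  have "L2_total M ?e"
    unfolding L2_total_def
  proof (intro ballI allI impI)
    fix f and \<epsilon> :: real assume f: "f \<in> L2_space M" and "\<epsilon> > 0"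
    then obtain k where k: "L2_norm M (\<lambda>x. f x - d k x) < \<epsilon>"
      using dense range_d by blast
    obtain c where c: "L2_norm M (\<lambda>x. d k x - (\<Sum>j<Suc k. c j * ?e j x)) = 0"
      using gram_schmidt_span[of d M k] d by blast
    have "L2_norm M (\<lambda>x. f x - (\<Sum>j<Suc k. c j * ?e j x))
        = L2_norm M (\<lambda>x. (f x - d k x) + (d k x - (\<Sum>j<Suc k. c j * ?e j x)))"
      by (simp add: algebra_simps del: sum.lessThan_Suc)
    also have "\<dots> \<le> L2_norm M (\<lambda>x. f x - d k x) + L2_norm M (\<lambda>x. d k x - (\<Sum>j<Suc k. c j * ?e j x))"
      by (intro L2_triangle L2_space_diff L2_space_lincomb f d e)
    finally show "\<exists>n c. L2_norm M (\<lambda>x. f x - (\<Sum>j<n. c j * ?e j x)) < \<epsilon>"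
      using c k by (intro exI[of _ "Suc k"] exI[of _ c]) linarith
  qed
  then show ?thesis
    using gram_schmidt_orthonormal_or_null[of d M] d by blast
qed

section \<open>Gaussian series\<close>

lemma norm_iexp_diff_le: "norm (iexp x - iexp y) \<le> \<bar>x - y\<bar>"
proof -
  have "iexp x - iexp y = iexp y * (iexp (x - y) - 1)"
    by (simp add: algebra_simps flip: exp_add)
  also have "norm \<dots> = norm (iexp (x - y) - 1)"
    by (simp add: norm_mult)
  also have "\<dots> \<le> \<bar>x - y\<bar>"
    using iexp_approx1[of "x - y" 0] by simp
  finally show ?thesis .
qed

text \<open>The map \<open>iexp\<close> is 1-Lipschitz and first moments are bounded by the L2 norm.
  Convergence in L2 thus gives pointwise convergence of characteristic functions.\<close>

lemma (in prob_space) char_distr_diff_le: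
  assumes X: "X \<in> L2_space M" and Y: "Y \<in> L2_space M"
  shows "norm (char (distr M borel X) t - char (distr M borel Y) t)
    \<le> \<bar>t\<bar> * L2_norm M (\<lambda>\<omega>. X \<omega> - Y \<omega>)"
proof -
  note [measurable] = L2_space_measurable[OF X] L2_space_measurable[OF Y]
  note XY = L2_space_diff[OF X Y]
  have int: "integrable M (\<lambda>\<omega>. iexp (t * X \<omega>))" "integrable M (\<lambda>\<omega>. iexp (t * Y \<omega>))"
    by (auto intro!: integrable_iexp)
  have "norm (char (distr M borel X) t - char (distr M borel Y) t)
      = norm (CLINT \<omega>|M. iexp (t * X \<omega>) - iexp (t * Y \<omega>))"
    using int by (simp add: char_def integral_distr)
  also have "\<dots> \<le> (\<integral>\<omega>. norm (iexp (t * X \<omega>) - iexp (t * Y \<omega>)) \<partial>M)"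
    by (rule integral_norm_bound)
  also have "\<dots> \<le> (\<integral>\<omega>. \<bar>t\<bar> * \<bar>X \<omega> - Y \<omega>\<bar> \<partial>M)"
  proof (intro integral_mono)
    show "integrable M (\<lambda>\<omega>. norm (iexp (t * X \<omega>) - iexp (t * Y \<omega>)))"
      using int by simp
    show "integrable M (\<lambda>\<omega>. \<bar>t\<bar> * \<bar>X \<omega> - Y \<omega>\<bar>)"
      using integral_abs_le_L2_norm(1)[OF XY] by simp
    show "norm (iexp (t * X \<omega>) - iexp (t * Y \<omega>)) \<le> \<bar>t\<bar> * \<bar>X \<omega> - Y \<omega>\<bar>" for \<omega>
      using norm_iexp_diff_le[of "t * X \<omega>" "t * Y \<omega>"]
      by (simp add: abs_mult flip: right_diff_distrib)
  qed
  also have "\<dots> \<le> \<bar>t\<bar> * L2_norm M (\<lambda>\<omega>. X \<omega> - Y \<omega>)"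
    using integral_abs_le_L2_norm(2)[OF XY] by (simp add: mult_left_mono)
  finally show ?thesis .
qed

lemma (in prob_space) char_distr_scale:
  assumes [measurable]: "X \<in> borel_measurable M"
  shows "char (distr M borel (\<lambda>\<omega>. c * X \<omega>)) t = char (distr M borel X) (t * c)"
  by (simp add: char_def integral_distr mult.assoc)

text \<open>Dividing by \<open>s\<close> reduces the claim to the standard normal law, which Levy's
  uniqueness theorem identifies.\<close>

lemma (in prob_space) distributed_normal_of_char:
  assumes X: "X \<in> borel_measurable M" and s: "s > 0"
    and char: "\<And>t. char (distr M borel X) t = exp (- ((s * t)\<^sup>2) / 2)"
  shows "distributed M lborel X (normal_density 0 s)"
proof -
  note [measurable] = X
  define Y where "Y \<omega> = inverse s * X \<omega>" for \<omega>
  have [measurable]: "Y \<in> borel_measurable M"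
    unfolding Y_def by measurable
  have "char (distr M borel Y) t = char std_normal_distribution t" for t
    using s unfolding Y_def char_distr_scale[OF X] char char_std_normal_distribution
    by (simp add: field_simps flip: exp_of_real)
  then have "distr M borel Y = std_normal_distribution"
    by (intro Levy_uniqueness real_dist_normal_dist real_distribution_distr ext) auto
  \<comment> \<open>Characteristic functions are taken over \<open>borel\<close>, densities over
    \<open>lborel\<close>; the two have the same measurable sets.\<close>
  moreover have "distr M borel Y = distr M lborel Y"
    by (intro distr_cong) auto
  ultimately have "distributed M lborel Y std_normal_density"
    by (simp add: distributed_def)
  then show ?thesis
    unfolding normal_standard_normal_convert[OF s] Y_def by (simp add: divide_inverse_commute)
qed

section \<open>Series in independent standard normal variables\<close>

locale standard_normal_sequence = prob_space P for P :: "'w measure" +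
  fixes \<xi> :: "nat \<Rightarrow> 'w \<Rightarrow> real"
  assumes indep: "indep_vars (\<lambda>_. borel) \<xi> UNIV"
    and std_normal: "\<And>k. distributed P lborel (\<xi> k) std_normal_density"
begin

lemma measurable_xi [measurable]: "\<xi> k \<in> borel_measurable P"
  using std_normal[of k] by (simp add: distributed_def)

lemma distr_xi: "distr P borel (\<xi> k) = std_normal_distribution"
proof -
  have "distr P borel (\<xi> k) = distr P lborel (\<xi> k)"
    by (intro distr_cong) auto
  then show ?thesis
    using std_normal[of k] by (simp add: distributed_def)
qed

lemma moments_xi: "integrable P (\<lambda>\<omega>. (\<xi> k \<omega>) ^ i)"
    "(\<integral>\<omega>. \<xi> k \<omega> \<partial>P) = 0" "(\<integral>\<omega>. (\<xi> k \<omega>)\<^sup>2 \<partial>P) = 1"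
proof -
  have "integrable (distr P borel (\<xi> k)) (\<lambda>x. x ^ i)"
    by (simp only: distr_xi integrable_std_normal_distribution_moment)
  then show "integrable P (\<lambda>\<omega>. (\<xi> k \<omega>) ^ i)"
    by (subst (asm) integrable_distr_eq) auto
  have "(\<integral>\<omega>. \<xi> k \<omega> \<partial>P) = (\<integral>x. x \<partial>distr P borel (\<xi> k))"
    by (simp add: integral_distr)
  also have "\<dots> = 0"
    using integral_std_normal_distribution_moment_odd[of 1] by (simp add: distr_xi)
  finally show "(\<integral>\<omega>. \<xi> k \<omega> \<partial>P) = 0" .
  have "(\<integral>\<omega>. (\<xi> k \<omega>)\<^sup>2 \<partial>P) = (\<integral>x. x\<^sup>2 \<partial>distr P borel (\<xi> k))"
    by (simp add: integral_distr)
  also have "\<dots> = 1"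
    using std_normal_distribution_even_moments(1)[of 1] by (simp add: distr_xi)
  finally show "(\<integral>\<omega>. (\<xi> k \<omega>)\<^sup>2 \<partial>P) = 1" .
qed

lemma L2_space_xi: "\<xi> k \<in> L2_space P"
  using moments_xi(1)[of k 2] by (simp add: L2_space_def)

lemma L2_inner_xi: "L2_inner P (\<xi> j) (\<xi> k) = (if j = k then 1 else 0)"
proof (cases "j = k")
  case True
  then show ?thesis
    using moments_xi(3)[of k] by (simp add: L2_inner_def power2_eq_square)
next
  case False
  then have "(\<integral>\<omega>. \<xi> j \<omega> * \<xi> k \<omega> \<partial>P) = (\<integral>\<omega>. \<xi> j \<omega> \<partial>P) * (\<integral>\<omega>. \<xi> k \<omega> \<partial>P)"
    using indep_vars_lebesgue_integral[of "{j, k}" \<xi>] indep_vars_subset[OF indep, of "{j, k}"]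
      moments_xi(1)[of _ 1] by simp
  then show ?thesis
    using False by (simp add: L2_inner_def moments_xi)
qed

lemma orthonormal_xi: "L2_orthonormal_or_null P \<xi>"
  by (simp add: L2_orthonormal_or_null_def L2_space_xi L2_inner_xi)

text \<open>Independence turns the characteristic function of the sum into a product, whose Gaussian
  exponents add up.\<close>

lemma char_distr_lincomb_xi:
  "char (distr P borel (\<lambda>\<omega>. \<Sum>k<n. b k * \<xi> k \<omega>)) t = exp (- ((\<Sum>k<n. (b k)\<^sup>2) * t\<^sup>2) / 2)"
proof -
  have "indep_vars (\<lambda>_. borel) (\<lambda>k \<omega>. b k * \<xi> k \<omega>) {..<n}"
    by (rule indep_vars_compose2[OF indep_vars_subset[OF indep]]) auto
  then have "char (distr P borel (\<lambda>\<omega>. \<Sum>k<n. b k * \<xi> k \<omega>)) t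
      = (\<Prod>k<n. char (distr P borel (\<lambda>\<omega>. b k * \<xi> k \<omega>)) t)"
    by (rule char_distr_sum)
  also have "\<dots> = (\<Prod>k<n. complex_of_real (exp (- ((b k)\<^sup>2 * t\<^sup>2) / 2)))"
    by (simp add: char_distr_scale distr_xi char_std_normal_distribution power_mult_distrib mult.commute)
  also have "\<dots> = complex_of_real (exp (\<Sum>k<n. - ((b k)\<^sup>2 * t\<^sup>2) / 2))"
    by (simp add: exp_sum)
  also have "(\<Sum>k<n. - ((b k)\<^sup>2 * t\<^sup>2) / 2) = - ((\<Sum>k<n. (b k)\<^sup>2) * t\<^sup>2) / 2"
    by (simp add: sum_negf sum_divide_distrib sum_distrib_right)
  finally show ?thesis
    by (simp flip: exp_of_real)
qed

lemma L2_sums_xi_variance: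
  assumes "L2_sums P (\<lambda>k \<omega>. b k * \<xi> k \<omega>) X"
  shows "(\<lambda>k. (b k)\<^sup>2) sums (L2_norm P X)\<^sup>2"
  using L2_sums_inner[OF assms assms]
  by (simp add: sums_def L2_norm_square L2_inner_orthonormal_or_null[OF orthonormal_xi] L2_inner_xi
      power2_eq_square[of "b _"])

text \<open>The mean is the inner product with the constant 1, hence continuous in L2, and every
  partial sum has mean 0.\<close>

lemma L2_sums_xi_expectation:
  assumes "L2_sums P (\<lambda>k \<omega>. b k * \<xi> k \<omega>) X"
  shows "(\<integral>\<omega>. X \<omega> \<partial>P) = 0"
proof -
  have X: "X \<in> L2_space P"
    using assms by (simp add: L2_sums_def)
  have one: "(\<lambda>\<omega>. 1) \<in> L2_space P"
    by (simp add: L2_space_def)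
  have "(\<lambda>n. L2_inner P (\<lambda>\<omega>. \<Sum>k<n. b k * \<xi> k \<omega>) (\<lambda>\<omega>. 1)) \<longlonglongrightarrow> L2_inner P X (\<lambda>\<omega>. 1)"
    using assms X one
    by (intro L2_inner_tendsto L2_space_lincomb L2_space_xi)
      (simp_all add: L2_sums_def L2_norm_def L2_inner_def)
  moreover have "L2_inner P (\<lambda>\<omega>. \<Sum>k<n. b k * \<xi> k \<omega>) (\<lambda>\<omega>. 1) = 0" for n
    using L2_inner_sum_left[of "{..<n}" \<xi> P "\<lambda>\<omega>. 1" b] L2_space_xi one
    by (simp add: L2_inner_def moments_xi)
  ultimately have "L2_inner P X (\<lambda>\<omega>. 1) = 0"
    by (simp add: LIMSEQ_const_iff)
  then show ?thesis
    by (simp add: L2_inner_def)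
qed

theorem L2_sums_xi_gaussian:
  assumes sums: "L2_sums P (\<lambda>k \<omega>. b k * \<xi> k \<omega>) X"
  shows "gaussian_rv P X"
proof (cases "L2_norm P X = 0")
  \<comment> \<open>A limit of norm 0 vanishes almost surely and is Gaussian in the degenerate
    sense.\<close>
  case True
  have "X \<in> L2_space P"
    using sums by (simp add: L2_sums_def)
  with True show ?thesis
    using L2_norm_zero_AE[of X P] by (auto simp: gaussian_rv_def L2_space_def)
next
  case False
  define s where "s = L2_norm P X"
  have s: "s > 0"
    using False L2_norm_nonneg[of P X] by (simp add: s_def)
  let ?S = "\<lambda>n \<omega>. \<Sum>k<n. b k * \<xi> k \<omega>"
  have X: "X \<in> L2_space P" and lim: "(\<lambda>n. L2_norm P (\<lambda>\<omega>. ?S n \<omega> - X \<omega>)) \<longlonglongrightarrow> 0"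
    using sums by (auto simp: L2_sums_def)
  have S: "?S n \<in> L2_space P" for n
    by (intro L2_space_lincomb L2_space_xi)
  have "char (distr P borel X) t = exp (- ((s * t)\<^sup>2) / 2)" for t
  \<comment> \<open>The characteristic functions of the partial sums have two limits: one from
    convergence in L2, one from the explicit formula and convergence of the variances.\<close>
  proof (rule LIMSEQ_unique)
    show "(\<lambda>n. char (distr P borel (?S n)) t) \<longlonglongrightarrow> char (distr P borel X) t"
    proof (rule Lim_null_comparison[THEN LIM_zero_cancel])
      show "\<forall>\<^sub>F n in sequentially. norm (char (distr P borel (?S n)) t - char (distr P borel X) t)
          \<le> \<bar>t\<bar> * L2_norm P (\<lambda>\<omega>. ?S n \<omega> - X \<omega>)"
        by (intro always_eventually allI char_distr_diff_le S X)
      show "(\<lambda>n. \<bar>t\<bar> * L2_norm P (\<lambda>\<omega>. ?S n \<omega> - X \<omega>)) \<longlonglongrightarrow> 0"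
        using lim by (rule tendsto_mult_right_zero)
    qed
    have "(\<lambda>n. \<Sum>k<n. (b k)\<^sup>2) \<longlonglongrightarrow> s\<^sup>2"
      using L2_sums_xi_variance[OF sums] by (simp add: sums_def s_def)
    then have "(\<lambda>n. complex_of_real (exp (- ((\<Sum>k<n. (b k)\<^sup>2) * t\<^sup>2) / 2)))
        \<longlonglongrightarrow> complex_of_real (exp (- (s\<^sup>2 * t\<^sup>2) / 2))"
      by (intro tendsto_intros) auto
    then show "(\<lambda>n. char (distr P borel (?S n)) t) \<longlonglongrightarrow> exp (- ((s * t)\<^sup>2) / 2)"
      by (simp add: char_distr_lincomb_xi power_mult_distrib flip: exp_of_real)
  qed
  then have "distributed P lborel X (normal_density 0 s)"
    using s X by (intro distributed_normal_of_char) (auto simp: L2_space_def)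
  then show ?thesis
    using s X by (auto simp: gaussian_rv_def L2_space_def)
qed

text \<open>A finite linear combination of the \<open>W A\<close> is again a series in the
  \<open>\<xi> k\<close>, with combined coefficients, so joint Gaussianity reduces to a single
  limit. The scalar series of products of coefficients sums to the covariance in \<open>P\<close>
  and, by Parseval in \<open>M\<close>, to the measure of the intersection.\<close>

theorem gaussian_process_L2_series:
  assumes \<phi>: "L2_orthonormal_or_null M \<phi>" "L2_total M \<phi>"
    and W: "\<And>A. A \<in> fmeasurable M \<Longrightarrow>
      L2_sums P (\<lambda>k \<omega>. L2_inner M (indicator A) (\<phi> k) * \<xi> k \<omega>) (W A)"
  shows "gaussian_process P M W"
proof -
  let ?a = "\<lambda>A k. L2_inner M (indicator A) (\<phi> k)"
  have "gaussian_rv P (\<lambda>\<omega>. \<Sum>A\<in>I. c A * W A \<omega>)" if I: "finite I" "I \<subseteq> fmeasurable M" for I c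
  proof (rule L2_sums_xi_gaussian)
    have "L2_sums P (\<lambda>k \<omega>. \<Sum>A\<in>I. c A * (?a A k * \<xi> k \<omega>)) (\<lambda>\<omega>. \<Sum>A\<in>I. c A * W A \<omega>)"
      using I by (intro L2_sums_lincomb W) auto
    then show "L2_sums P (\<lambda>k \<omega>. (\<Sum>A\<in>I. c A * ?a A k) * \<xi> k \<omega>) (\<lambda>\<omega>. \<Sum>A\<in>I. c A * W A \<omega>)"
      by (simp add: sum_distrib_right mult.assoc)
  qed
  moreover have "(\<integral>\<omega>. W A \<omega> * W B \<omega> \<partial>P) = measure M (A \<inter> B)"
    if A: "A \<in> fmeasurable M" and B: "B \<in> fmeasurable M" for A B
  proof (rule sums_unique2)
    show "(\<lambda>k. ?a A k * ?a B k) sums (\<integral>\<omega>. W A \<omega> * W B \<omega> \<partial>P)"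
      using L2_sums_inner[OF W[OF A] W[OF B]]
      by (simp add: sums_def L2_inner_orthonormal_or_null[OF orthonormal_xi] L2_inner_xi
          flip: L2_inner_def)
    have "L2_inner M (indicator A) (indicator B) = measure M (A \<inter> B)"
      \<comment> \<open>The integral of an indicator measures the intersection with
        \<open>space M\<close>, which \<open>A\<close> absorbs.\<close>
      using A B sets.sets_into_space[of A M]
      by (auto simp: L2_inner_def indicator_inter_arith[symmetric] Int_absorb2 le_infI1)
    then show "(\<lambda>k. ?a A k * ?a B k) sums measure M (A \<inter> B)"
      using L2_Parseval[OF \<phi> L2_space_indicator[OF A] L2_space_indicator[OF B]] by simp
  qed
  ultimately show ?thesis
    using L2_sums_xi_expectation[OF W]
    by (auto simp: gaussian_process_def jointly_gaussian_def prob_space_axioms)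
qed

text \<open>Parseval for \<open>f\<close> with itself makes the coefficients square
  summable.\<close>

lemma L2_series_exists:
  assumes \<phi>: "L2_orthonormal_or_null M \<phi>" "L2_total M \<phi>" and f: "f \<in> L2_space M"
  shows "\<exists>X. L2_sums P (\<lambda>k \<omega>. L2_inner M f (\<phi> k) * \<xi> k \<omega>) X"
  using L2_Parseval[OF \<phi> f f] orthonormal_xi
  by (intro L2_sums_square_summable) (auto simp: power2_eq_square sums_iff)

end

section \<open>The coordinates of the Gaussian product space and the realization\<close>

lemma prob_space_std_normal: "prob_space std_normal_distribution"
  by (rule prob_space_normal_density) simp

lemma distr_Z: "distr gaussian_product borel (Z k) = std_normal_distribution"
proof -
  have "distr gaussian_product borel (Z k)
      = distr gaussian_product std_normal_distribution (\<lambda>\<omega>. \<omega> k)"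
    by (intro distr_cong) (simp_all add: Z_def)
  then show ?thesis
    unfolding gaussian_product_def
    by (simp add: distr_PiM_component[of UNIV "\<lambda>_. std_normal_distribution"] prob_space_std_normal)
qed

lemma measurable_Z [measurable]: "Z k \<in> borel_measurable gaussian_product"
proof -
  have "(\<lambda>\<omega>. \<omega> k) \<in> measurable gaussian_product std_normal_distribution"
    unfolding gaussian_product_def by (rule measurable_component_singleton) simp
  then show ?thesis
    by (simp add: Z_def[abs_def] cong: measurable_cong_sets)
qed

interpretation gaussian_product: standard_normal_sequence gaussian_product Z
proof -
  interpret prob_space gaussian_product
    unfolding gaussian_product_def by (intro prob_space_PiM prob_space_std_normal)
  show "standard_normal_sequence gaussian_product Z"
  proof
    \<comment> \<open>All coordinates together form the identity map, so their joint law is the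
      product measure itself; independence says that it is the product of the marginal laws.\<close>
    have "distr gaussian_product (PiM UNIV (\<lambda>_. borel)) (\<lambda>\<omega>. \<lambda>i\<in>UNIV. Z i \<omega>)
        = distr gaussian_product gaussian_product (\<lambda>\<omega>. \<omega>)"
      unfolding gaussian_product_def
      by (intro distr_cong sets_PiM_cong) (simp_all add: Z_def restrict_def)
    then show "indep_vars (\<lambda>_. borel) Z UNIV"
      by (subst indep_vars_iff_distr_eq_PiM) (simp_all add: distr_Z flip: gaussian_product_def)
    show "distributed gaussian_product lborel (Z k) std_normal_density" for k
    proof -
      have "distr gaussian_product lborel (Z k) = distr gaussian_product borel (Z k)"
        by (intro distr_cong) auto
      then show ?thesis
        by (simp add: distributed_def distr_Z)
    qed
  qed
qed

text \<open>A sum in L2 is determined only almost everywhere. For a basis, the conclusion therefore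
  states that the series converges for each set and that every choice \<open>W\<close> of
  representatives of the sums is a Gaussian process.\<close>

theorem theorem3p31:
  fixes M :: "'a measure"
  assumes "sigma_finite_measure M"
  shows "(L2_separable M \<longrightarrow> (\<exists>W. gaussian_process gaussian_product M W)) \<and>
    prob_space.indep_vars gaussian_product (\<lambda>_. borel) Z UNIV \<and>
    (\<forall>k. distributed gaussian_product lborel (Z k) std_normal_density) \<and>
    (\<forall>\<phi>. L2_orthonormal_basis M \<phi> \<longrightarrow>
      (\<forall>A\<in>fmeasurable M. \<exists>X. L2_sums gaussian_product
          (\<lambda>k \<omega>. (LINT x:A|M. \<phi> k x) * Z k \<omega>) X) \<and>
      (\<forall>W. (\<forall>A\<in>fmeasurable M. L2_sums gaussian_product
          (\<lambda>k \<omega>. (LINT x:A|M. \<phi> k x) * Z k \<omega>) (W A)) \<longrightarrow>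
        gaussian_process gaussian_product M W))"
proof (intro conjI impI allI)
  assume "L2_separable M"
  then obtain \<phi> where \<phi>: "L2_orthonormal_or_null M \<phi>" "L2_total M \<phi>"
    using L2_separable_imp_basis by blast
  \<comment> \<open>The axiom of choice picks one representative of the sum for every set at
    once.\<close>
  have "\<exists>W. \<forall>A\<in>fmeasurable M.
      L2_sums gaussian_product (\<lambda>k \<omega>. L2_inner M (indicator A) (\<phi> k) * Z k \<omega>) (W A)"
    by (intro bchoice ballI gaussian_product.L2_series_exists[OF \<phi>] L2_space_indicator)
  then show "\<exists>W. gaussian_process gaussian_product M W"
    using gaussian_product.gaussian_process_L2_series[OF \<phi>] by blast
next
  show "prob_space.indep_vars gaussian_product (\<lambda>_. borel) Z UNIV"
    by (rule gaussian_product.indep)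
  show "distributed gaussian_product lborel (Z k) std_normal_density" for k
    by (rule gaussian_product.std_normal)
next
  fix \<phi> assume "L2_orthonormal_basis M \<phi>"
  then have \<phi>: "L2_orthonormal_or_null M \<phi>" "L2_total M \<phi>"
    by (simp_all add: L2_orthonormal_basis_iff)
  have coeff: "(LINT x:A|M. \<phi> k x) = L2_inner M (indicator A) (\<phi> k)" for A k
    by (simp add: set_lebesgue_integral_def L2_inner_def)
  show "\<forall>A\<in>fmeasurable M. \<exists>X. L2_sums gaussian_product (\<lambda>k \<omega>. (LINT x:A|M. \<phi> k x) * Z k \<omega>) X"
    unfolding coeff by (intro ballI gaussian_product.L2_series_exists[OF \<phi>] L2_space_indicator)
  fix W
  assume "\<forall>A\<in>fmeasurable M. L2_sums gaussian_product (\<lambda>k \<omega>. (LINT x:A|M. \<phi> k x) * Z k \<omega>) (W A)"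
  then show "gaussian_process gaussian_product M W"
    unfolding coeff by (intro gaussian_product.gaussian_process_L2_series[OF \<phi>]) blast
qed

end
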